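(* Let $m=2$ and let $0<\alpha_1<\alpha_2<1$. Consider the step up (SU) test with critical values $\alpha_1,\alpha_2$. Let $p_1$ and $p_2$ be p-values, each uniformly distributed on $[0,1]$, with arbitrary dependence between them. Then $$\mathrm{FDR}\leqslant \min(\alpha_1+\alpha_2,\,1).$$ Moreover, if $\alpha_1+\alpha_2<1$, the inequality is sharp, i.e. there exists a joint distribution of $(p_1,p_2)$ with marginals uniform on $[0,1]$ (and a set $I_0\subseteq\{1,2\}$ of true null hypotheses) for which $\mathrm{FDR}=\alpha_1+\alpha_2$.
   Context: Multiple testing setting: there are $m$ null hypotheses $H_1,\dots,H_m$ with p-values $p=(p_1,\dots,p_m)$, a random vector in $[0,1]^m$ with distribution $P$. The index set is a disjoint union $\{1,\dots,m\}=I_0\cup I_1$, where $I_0$ is the set of indices of true null hypotheses and $I_1$ that of false null hypotheses; this partition is fixed (non-random) but unknown, and $m_0=\#I_0$. A multiple test is a map $\phi=(\phi_1,\dots,\phi_m):[0,1]^m\to\{0,1\}^m$ which rejects $H_i$ iff $\phi_i(p)=1$. Let $R=\#\{i:\phi_i(p)=1\}$ be the number of rejections and $V=\#\{i\in I_0:\phi_i(p)=1\}$ the number of false rejections. The false discovery rate is $$\mathrm{FDR}=\mathbb{E}\left[\frac{V}{\max(R,1)}\right].$$ Step up (SU) test: let $p_{1:m}\leqslant\dots\leqslant p_{m:m}$ be the order statistics of $p$ and let $0=\alpha_0<\alpha_1\leqslant\dots\leqslant\alpha_m<1$ be critical values. Put $R=\max\{j\in\{1,\dots,m\}:\ p_{j:m}\leqslant\alpha_j\}$,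 with $\max\emptyset=0$. The SU test rejects $H_i$ iff $p_i\leqslant\alpha_R$ (no hypothesis is rejected if $R=0$); $R$ is then its number of rejections. *)

theory Defs
  imports "HOL-Probability.Probability"
begin

text \<open>
  Hypotheses are indexed by \<open>{1..m}\<close> and a vector of p-values is a function \<open>x :: nat \<Rightarrow> real\<close> of which
  only the values on \<open>{1..m}\<close> matter. A multiple test is a map \<open>\<phi>\<close> such that \<open>\<phi> x i\<close> holds iff the
  \<open>i\<close>-th null hypothesis is rejected on observing \<open>x\<close>.
\<close>

type_synonym mult_test = "(nat \<Rightarrow> real) \<Rightarrow> nat \<Rightarrow> bool"

definition num_rejections :: "nat \<Rightarrow> mult_test \<Rightarrow> (nat \<Rightarrow> real) \<Rightarrow> nat" where
  "num_rejections m \<phi> x = card {i \<in> {1..m}. \<phi> x i}"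

definition num_false_rejections :: "nat set \<Rightarrow> mult_test \<Rightarrow> (nat \<Rightarrow> real) \<Rightarrow> nat" where
  "num_false_rejections I\<^sub>0 \<phi> x = card {i \<in> I\<^sub>0. \<phi> x i}"

definition FDR :: "'a measure \<Rightarrow> nat \<Rightarrow> nat set \<Rightarrow> (nat \<Rightarrow> 'a \<Rightarrow> real) \<Rightarrow> mult_test \<Rightarrow> real" where
  "FDR M m I\<^sub>0 p \<phi> =
     (\<integral>\<omega>. real (num_false_rejections I\<^sub>0 \<phi> (\<lambda>i. p i \<omega>))
          / real (max (num_rejections m \<phi> (\<lambda>i. p i \<omega>)) 1) \<partial>M)"

text \<open>The \<open>j\<close>-th smallest of \<open>x 1, \<dots>, x m\<close>, for \<open>1 \<le> j \<le> m\<close>.\<close>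

definition order_stat :: "nat \<Rightarrow> (nat \<Rightarrow> real) \<Rightarrow> nat \<Rightarrow> real" where
  "order_stat m x j = sort (map x [1..<Suc m]) ! (j - 1)"

definition step_up_index :: "nat \<Rightarrow> (nat \<Rightarrow> real) \<Rightarrow> (nat \<Rightarrow> real) \<Rightarrow> nat" where
  "step_up_index m \<alpha> x =
     (let J = {j \<in> {1..m}. order_stat m x j \<le> \<alpha> j} in if J = {} then 0 else Max J)"

text \<open>
  Critical values are \<open>\<alpha> 1, \<dots>, \<alpha> m\<close>. Nothing is rejected when the step-up index is \<open>0\<close>, so the value
  \<open>\<alpha> 0\<close> (conventionally \<open>0\<close>) plays no role.
\<close>

definition step_up :: "nat \<Rightarrow> (nat \<Rightarrow> real) \<Rightarrow> mult_test" where
  "step_up m \<alpha> x i \<longleftrightarrow> step_up_index m \<alpha> x \<noteq> 0 \<and> x i \<le> \<alpha> (step_up_index m \<alpha> x)"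

text \<open>No assumption is made on the dependence between the p-values.\<close>

definition uniform_pvalues :: "'a measure \<Rightarrow> nat \<Rightarrow> (nat \<Rightarrow> 'a \<Rightarrow> real) \<Rightarrow> bool" where
  "uniform_pvalues M m p \<longleftrightarrow>
     prob_space M \<and>
     (\<forall>i\<in>{1..m}. p i \<in> borel_measurable M \<and> (\<forall>\<omega>\<in>space M. p i \<omega> \<in> {0..1}) \<and>
        distr M borel (p i) = uniform_measure lborel {0..1})"

text \<open>The unit cube \<open>[0,1]\<^sup>m\<close>, as a measurable space.\<close>

definition unit_cube :: "nat \<Rightarrow> (nat \<Rightarrow> real) measure" where
  "unit_cube m = (\<Pi>\<^sub>M i\<in>{1..m}. restrict_space borel {0..1})"

end

theory Submission
  imports Defs
begin

text \<open>
  Write \<open>a = \<alpha> 1\<close>, \<open>b = \<alpha> 2\<close>, and let \<open>E\<close> be the event that the test rejects at least one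
  hypothesis, that is, that some p-value is at most \<open>a\<close> or both are at most \<open>b\<close>
  (\<open>rejects_some_iff\<close>). Whichever hypotheses are true, the false discovery proportion is at most
  the indicator of \<open>E\<close>, with equality if both are true, so the FDR is controlled by the probability
  of \<open>E\<close>.

  The bound is a counting argument. If \<open>p i \<le> a\<close>, then also \<open>p i \<le> b\<close>; hence whenever \<open>E\<close> occurs, at
  least two of the four events \<open>p i \<le> a\<close>, \<open>p i \<le> b\<close> occur. Their probabilities add up to
  \<open>2 (a + b)\<close> by uniformity of the marginals, so \<open>E\<close> has probability at most \<open>a + b\<close>
  (\<open>FDR_step_up_two_le\<close>).

  Equality requires that, almost surely, exactly two of the four events occur on \<open>E\<close> and none off
  \<open>E\<close>. So a p-value below \<open>a\<close> must be accompanied by one above \<open>b\<close>, and the p-values must enter \<open>(a, b]\<close>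
  simultaneously. Take \<open>p 1 = U\<close> uniform, and let \<open>p 2\<close> be \<open>1 - U\<close> if \<open>U\<close> is within \<open>a\<close> of an endpoint
  of \<open>[0,1]\<close> and \<open>U\<close> otherwise. Because the set where \<open>U\<close> is reflected is symmetric about \<open>1/2\<close>,
  \<open>p 2\<close> is again uniform (\<open>swap_ends_preserves_uniform\<close>). Because \<open>a + b < 1\<close>, the end interval
  \<open>[1 - a, 1]\<close> lies above \<open>b\<close>, as needed; \<open>E\<close> becomes the event that \<open>U \<in> [0, b] \<union> [1 - a, 1]\<close>, a
  disjoint union of length \<open>a + b\<close> (\<open>FDR_swap_law\<close>).
\<close>

section \<open>The step up test for two hypotheses\<close>

lemma order_stat_two:
  "order_stat 2 x 1 = min (x 1) (x 2)" "order_stat 2 x 2 = max (x 1) (x 2)"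
  by (simp_all add: order_stat_def upt_rec numeral_2_eq_2)

lemma step_up_index_two:
  "step_up_index 2 \<alpha> x =
     (if max (x 1) (x 2) \<le> \<alpha> 2 then 2 else if min (x 1) (x 2) \<le> \<alpha> 1 then 1 else 0)"
proof -
  have "{j \<in> {1..2}. order_stat 2 x j \<le> \<alpha> j} =
      (if max (x 1) (x 2) \<le> \<alpha> 2 then {2} else {}) \<union> (if min (x 1) (x 2) \<le> \<alpha> 1 then {1} else {})"
  proof -
    have "{1..2} = {1, 2::nat}" by auto
    then show ?thesis
      using order_stat_two[of x] by auto
  qed
  then show ?thesis
    unfolding step_up_index_def Let_def by (simp del: One_nat_def)
qed

definition rejects_some :: "(nat \<Rightarrow> real) \<Rightarrow> (nat \<Rightarrow> real) \<Rightarrow> bool" where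
  "rejects_some \<alpha> x \<longleftrightarrow> x 1 \<le> \<alpha> 1 \<or> x 2 \<le> \<alpha> 1 \<or> x 1 \<le> \<alpha> 2 \<and> x 2 \<le> \<alpha> 2"

lemma rejects_some_iff:
  assumes "\<alpha> 1 \<le> \<alpha> 2"
  shows "rejects_some \<alpha> x \<longleftrightarrow> (\<exists>i\<in>{1..2}. step_up 2 \<alpha> x i)"
proof -
  have "{1..2} = {1, 2::nat}" by auto
  then show ?thesis
    using assms unfolding step_up_def step_up_index_two rejects_some_def
    by (auto simp del: One_nat_def simp: min_def max_def split: if_splits)
qed

text \<open>
  At most all rejections are false, so the proportion is at most 1; without rejections it is 0.
\<close>

lemma FDP_le_indicator:
  fixes \<alpha> :: "nat \<Rightarrow> real"
  assumes "\<alpha> 1 \<le> \<alpha> 2" and I\<^sub>0: "I\<^sub>0 \<subseteq> {1..2}"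
  shows "real (num_false_rejections I\<^sub>0 (step_up 2 \<alpha>) x) / real (max (num_rejections 2 (step_up 2 \<alpha>) x) 1)
           \<le> of_bool (rejects_some \<alpha> x)"
proof (cases "rejects_some \<alpha> x")
  case True
  have "num_false_rejections I\<^sub>0 (step_up 2 \<alpha>) x \<le> num_rejections 2 (step_up 2 \<alpha>) x"
    unfolding num_false_rejections_def num_rejections_def using I\<^sub>0 by (intro card_mono) auto
  then show ?thesis using True by (simp add: divide_le_eq_1 less_max_iff_disj le_max_iff_disj)
next
  case False
  then have "{i \<in> I\<^sub>0. step_up 2 \<alpha> x i} = {}"
    using I\<^sub>0 rejects_some_iff[of \<alpha> x] assms(1) by blast
  then have "num_false_rejections I\<^sub>0 (step_up 2 \<alpha>) x = 0"
    unfolding num_false_rejections_def by (simp only: card.empty)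
  then show ?thesis by simp
qed

text \<open>
  If every null hypothesis is true, then every rejection is false. This is why the configuration
  with \<open>I\<^sub>0 = {1..2}\<close> is the extremal one.
\<close>

lemma FDP_all_true_eq_indicator:
  fixes \<alpha> :: "nat \<Rightarrow> real"
  assumes "\<alpha> 1 \<le> \<alpha> 2"
  shows "real (num_false_rejections {1..2} (step_up 2 \<alpha>) x) / real (max (num_rejections 2 (step_up 2 \<alpha>) x) 1)
           = of_bool (rejects_some \<alpha> x)"
proof -
  let ?R = "{i \<in> {1..2}. step_up 2 \<alpha> x i}"
  have "finite ?R" by simp
  then have pos: "0 < card ?R \<longleftrightarrow> rejects_some \<alpha> x"
    unfolding card_gt_0_iff using rejects_some_iff[of \<alpha> x] assms by blast
  have "real n / real (max n 1) = of_bool (0 < n)" for n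
    by (cases n) simp_all
  then show ?thesis
    unfolding num_false_rejections_def num_rejections_def pos[symmetric] .
qed

section \<open>The upper bound\<close>

lemma uniform_pvalue_cdf:
  assumes "uniform_pvalues M m p" and "i \<in> {1..m}" and c: "0 \<le> c" "c \<le> 1"
  shows "measure M {\<omega> \<in> space M. p i \<omega> \<le> c} = c"
proof -
  have [measurable]: "p i \<in> borel_measurable M"
    and *: "distr M borel (p i) = uniform_measure lborel {0..1}"
    using assms unfolding uniform_pvalues_def by auto
  have "measure M {\<omega> \<in> space M. p i \<omega> \<le> c} = measure (distr M borel (p i)) {..c}"
    by (subst measure_distr) (auto intro!: arg_cong[where f="measure M"])
  also have "\<dots> = measure lborel ({0..1} \<inter> {..c})"
    unfolding * by (subst measure_uniform_measure) auto
  also have "{0..1} \<inter> {..c} = {0..c}" using c by auto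
  finally show ?thesis using c by simp
qed

lemma FDR_step_up_two_le:
  fixes \<alpha> :: "nat \<Rightarrow> real"
  assumes \<alpha>: "0 < \<alpha> 1" "\<alpha> 1 < \<alpha> 2" "\<alpha> 2 < 1"
    and p: "uniform_pvalues M 2 p" and I\<^sub>0: "I\<^sub>0 \<subseteq> {1..2}"
  shows "FDR M 2 I\<^sub>0 p (step_up 2 \<alpha>) \<le> min (\<alpha> 1 + \<alpha> 2) 1"
proof -
  interpret prob_space M using p by (simp add: uniform_pvalues_def)
  have [measurable]: "p 1 \<in> borel_measurable M" "p 2 \<in> borel_measurable M"
    using p by (auto simp: uniform_pvalues_def)
  define E where "E = {\<omega> \<in> space M. rejects_some \<alpha> (\<lambda>i. p i \<omega>)}"
  define F where "F i c = {\<omega> \<in> space M. p i \<omega> \<le> c}" for i c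
  have [measurable]: "E \<in> sets M" "F 1 c \<in> sets M" "F 2 c \<in> sets M" for c
    unfolding E_def F_def rejects_some_def by measurable
  have "FDR M 2 I\<^sub>0 p (step_up 2 \<alpha>) \<le> (\<integral>\<omega>. indicator E \<omega> \<partial>M)"
    unfolding FDR_def
  proof (rule integral_mono')
    fix \<omega> assume "\<omega> \<in> space M"
    then show "real (num_false_rejections I\<^sub>0 (step_up 2 \<alpha>) (\<lambda>i. p i \<omega>)) /
        real (max (num_rejections 2 (step_up 2 \<alpha>) (\<lambda>i. p i \<omega>)) 1) \<le> indicator E \<omega>"
      using FDP_le_indicator[of \<alpha> I\<^sub>0 "\<lambda>i. p i \<omega>"] \<alpha> I\<^sub>0
      by (simp add: E_def indicator_def del: One_nat_def)
  qed (auto intro!: integrable_real_indicator simp: emeasure_eq_measure)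
  also have E: "\<dots> = prob E" by simp
  finally have FDR_le: "FDR M 2 I\<^sub>0 p (step_up 2 \<alpha>) \<le> prob E" .
  \<comment> \<open>On \<open>E\<close> at least two of the four events \<open>p i \<le> \<alpha> j\<close> occur, since \<open>p i \<le> \<alpha> 1\<close> entails \<open>p i \<le> \<alpha> 2\<close>.\<close>
  have "prob E \<le> (\<integral>\<omega>. (indicator (F 1 (\<alpha> 1)) \<omega> + indicator (F 1 (\<alpha> 2)) \<omega>
      + indicator (F 2 (\<alpha> 1)) \<omega> + indicator (F 2 (\<alpha> 2)) \<omega>) / 2 \<partial>M)"
    unfolding E[symmetric]
  proof (rule integral_mono)
    fix \<omega> assume "\<omega> \<in> space M"
    then show "indicator E \<omega> \<le> (indicator (F 1 (\<alpha> 1)) \<omega> + indicator (F 1 (\<alpha> 2)) \<omega>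
      + indicator (F 2 (\<alpha> 1)) \<omega> + indicator (F 2 (\<alpha> 2)) \<omega>) / (2::real)"
      using \<alpha> by (auto simp: E_def F_def rejects_some_def indicator_def simp del: One_nat_def)
  qed (auto intro!: integrable_real_indicator simp: emeasure_eq_measure simp del: One_nat_def)
  also have "\<dots> = (prob (F 1 (\<alpha> 1)) + prob (F 1 (\<alpha> 2)) + prob (F 2 (\<alpha> 1)) + prob (F 2 (\<alpha> 2))) / 2"
    by (simp add: emeasure_eq_measure del: One_nat_def)
  also have "\<dots> = \<alpha> 1 + \<alpha> 2"
    using uniform_pvalue_cdf[OF p] \<alpha> by (simp add: F_def del: One_nat_def)
  finally show ?thesis using FDR_le prob_le_1[of E] by linarith
qed

section \<open>A dependence attaining the bound\<close>

definition swap_ends :: "real \<Rightarrow> real \<Rightarrow> real" where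
  "swap_ends a u = (if u \<le> a \<or> 1 - a \<le> u then 1 - u else u)"

lemma swap_ends_measurable [measurable]: "swap_ends a \<in> borel_measurable borel"
  unfolding swap_ends_def by measurable

lemma swap_ends_range: "u \<in> {0..1} \<Longrightarrow> swap_ends a u \<in> {0..1}"
  by (auto simp: swap_ends_def)

lemma emeasure_lborel_reflect:
  fixes A :: "real set"
  assumes [measurable]: "A \<in> sets borel"
  shows "emeasure lborel ((\<lambda>u. 1 - u) -` A) = emeasure lborel A"
proof -
  have "lborel = density (distr lborel borel (\<lambda>u::real. 1 + (-1) * u)) (\<lambda>_. ennreal \<bar>- 1\<bar>)"
    by (rule lborel_real_affine) simp
  then have "lborel = distr lborel borel (\<lambda>u::real. 1 - u)"
    by (simp add: density_1)
  then have "emeasure lborel A = emeasure (distr lborel borel (\<lambda>u::real. 1 - u)) A"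
    by simp
  then show ?thesis by (simp add: emeasure_distr)
qed

text \<open>
  The map sends the part \<open>S\<close> of the unit interval near its endpoints to itself by reflection and fixes
  the rest pointwise. Reflection preserves length, so the preimage of \<open>A\<close> has the same length as \<open>A\<close>,
  piece by piece.
\<close>

lemma swap_ends_preserves_uniform:
  "distr (uniform_measure lborel {0..1}) borel (swap_ends a) = uniform_measure lborel {0..1}"
proof (rule measure_eqI)
  fix A :: "real set" assume "A \<in> sets (distr (uniform_measure lborel {0..1}) borel (swap_ends a))"
  then have [measurable]: "A \<in> sets borel" by simp
  define S where "S = {u \<in> {0..1}. u \<le> a \<or> 1 - a \<le> u}"
  have [measurable]: "S \<in> sets borel" unfolding S_def by measurable
  have sym: "(\<lambda>u. 1 - u) -` (A \<inter> S) = {u \<in> S. 1 - u \<in> A}"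
    by (auto simp: S_def)
  have reflected_in_S: "1 - u \<in> S \<Longrightarrow> u \<in> S" for u
    by (auto simp: S_def)
  have "emeasure lborel ({0..1} \<inter> swap_ends a -` A)
      = emeasure lborel ((A \<inter> ({0..1} - S)) \<union> (\<lambda>u. 1 - u) -` (A \<inter> S))"
    unfolding sym by (rule arg_cong[where f="emeasure lborel"])
      (auto simp: S_def swap_ends_def split: if_splits)
  also have "\<dots> = emeasure lborel (A \<inter> ({0..1} - S)) + emeasure lborel ((\<lambda>u. 1 - u) -` (A \<inter> S))"
  proof (rule plus_emeasure[symmetric])
    show "(\<lambda>u. 1 - u) -` (A \<inter> S) \<in> sets lborel"
      using measurable_sets[of "\<lambda>u. 1 - u" borel borel "A \<inter> S"] by simp
  qed (auto simp: sym dest: reflected_in_S)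
  also have "\<dots> = emeasure lborel (A \<inter> ({0..1} - S)) + emeasure lborel (A \<inter> S)"
    by (subst emeasure_lborel_reflect) simp_all
  also have "\<dots> = emeasure lborel ((A \<inter> ({0..1} - S)) \<union> (A \<inter> S))"
    by (rule plus_emeasure) auto
  also have "(A \<inter> ({0..1} - S)) \<union> (A \<inter> S) = {0..1} \<inter> A"
    by (auto simp: S_def)
  finally have "emeasure lborel ({0..1} \<inter> swap_ends a -` A) = emeasure lborel ({0..1} \<inter> A)" .
  moreover have "swap_ends a -` A \<in> sets lborel"
    using measurable_sets[OF swap_ends_measurable \<open>A \<in> sets borel\<close>, of a] by simp
  ultimately show "emeasure (distr (uniform_measure lborel {0..1}) borel (swap_ends a)) A =
      emeasure (uniform_measure lborel {0..1}) A"
    by (simp add: emeasure_distr)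
qed simp

text \<open>
  The joint law of \<open>U\<close> and \<open>swap_ends a U\<close>. The source is the restriction of Lebesgue measure to the
  unit interval, rather than the uniform measure on the whole line, because the pair must lie in the
  cube for every point of the source space.
\<close>

definition swap_law :: "real \<Rightarrow> (nat \<Rightarrow> real) measure" where
  "swap_law a = distr (restrict_space lborel {0..1}) (unit_cube 2)
     (\<lambda>u. \<lambda>i\<in>{1..2}. if i = 1 then u else swap_ends a u)"

lemma swap_law_map_measurable:
  "(\<lambda>u. \<lambda>i\<in>{1..2::nat}. if i = 1 then u else swap_ends a u)
     \<in> restrict_space lborel {0..1} \<rightarrow>\<^sub>M unit_cube 2"
  unfolding unit_cube_def
proof (rule measurable_restrict)
  fix i :: nat
  show "(\<lambda>u. if i = 1 then u else swap_ends a u)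
      \<in> restrict_space lborel {0..1} \<rightarrow>\<^sub>M restrict_space borel {0..1}"
    by (intro measurable_restrict_space2 measurable_restrict_space1)
      (auto simp: space_restrict_space swap_ends_range simp del: One_nat_def atLeastAtMost_iff)
qed

lemma unit_cube_coordinate_measurable:
  assumes "i \<in> {1..m}" shows "(\<lambda>x. x i) \<in> borel_measurable (unit_cube m)"
proof -
  have "(\<lambda>x. x i) \<in> unit_cube m \<rightarrow>\<^sub>M restrict_space borel {0..1}"
    unfolding unit_cube_def using assms by (rule measurable_component_singleton)
  then show ?thesis by (simp add: measurable_restrict_space2_iff)
qed

lemma distr_restrict_lborel_eq_uniform:
  assumes [measurable]: "f \<in> borel_measurable borel"
  shows "distr (restrict_space lborel {0..1}) borel f
    = distr (uniform_measure lborel {0..1::real}) borel f"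
proof (rule measure_eqI)
  fix A assume "A \<in> sets (distr (restrict_space lborel {0..1}) borel f)"
  then have [measurable]: "A \<in> sets borel" by simp
  have [measurable]: "f \<in> borel_measurable (restrict_space lborel {0..1})"
    by (intro measurable_restrict_space1) simp
  have "f -` A \<in> sets lborel"
    using measurable_sets[OF assms \<open>A \<in> sets borel\<close>] by simp
  then show "emeasure (distr (restrict_space lborel {0..1}) borel f) A
      = emeasure (distr (uniform_measure lborel {0..1}) borel f) A"
    by (simp add: emeasure_distr emeasure_restrict_space space_restrict_space Int_commute
        divide_ennreal_def)
qed simp

lemma uniform_pvalues_swap_law: "uniform_pvalues (swap_law a) 2 (\<lambda>i x. x i)"
proof -
  let ?h = "\<lambda>u. \<lambda>i\<in>{1..2::nat}. if i = 1 then u else swap_ends a u"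
  have "prob_space (restrict_space lborel {0..1::real})"
    by (rule prob_spaceI) (simp add: space_restrict_space emeasure_restrict_space)
  then have "prob_space (swap_law a)"
    unfolding swap_law_def by (rule prob_space.prob_space_distr[OF _ swap_law_map_measurable])
  moreover have "(\<lambda>x. x i) \<in> borel_measurable (swap_law a) \<and> (\<forall>x\<in>space (swap_law a). x i \<in> {0..1})
      \<and> distr (swap_law a) borel (\<lambda>x. x i) = uniform_measure lborel {0..1}" if i: "i \<in> {1..2}" for i
  proof (intro conjI)
    show "(\<lambda>x. x i) \<in> borel_measurable (swap_law a)"
      using unit_cube_coordinate_measurable[OF i] by (simp add: swap_law_def)
    show "\<forall>x\<in>space (swap_law a). x i \<in> {0..1}"
      using i by (auto simp: swap_law_def unit_cube_def space_PiM space_restrict_space PiE_def Pi_def)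
    have "distr (swap_law a) borel (\<lambda>x. x i) = distr (restrict_space lborel {0..1}) borel ((\<lambda>x. x i) \<circ> ?h)"
      unfolding swap_law_def
      by (rule distr_distr[OF unit_cube_coordinate_measurable[OF i] swap_law_map_measurable])
    also have "(\<lambda>x. x i) \<circ> ?h = (if i = 1 then (\<lambda>u. u) else swap_ends a)"
      using i by auto
    also have "distr (restrict_space lborel {0..1}) borel \<dots> =
        distr (uniform_measure lborel {0..1}) borel (if i = 1 then (\<lambda>u. u) else swap_ends a)"
      by (rule distr_restrict_lborel_eq_uniform) simp
    also have "\<dots> = uniform_measure lborel {0..1}"
    proof (cases "i = 1")
      case True
      then show ?thesis by (simp add: distr_id2)
    qed (simp add: swap_ends_preserves_uniform)
    finally show "distr (swap_law a) borel (\<lambda>x. x i) = uniform_measure lborel {0..1}" .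
  qed
  ultimately show ?thesis unfolding uniform_pvalues_def by blast
qed

text \<open>
  Rejection in terms of \<open>U\<close>: for \<open>U \<le> \<alpha> 1\<close> the first p-value alone is small enough; for
  \<open>\<alpha> 1 < U \<le> \<alpha> 2\<close> both p-values equal \<open>U\<close>; for \<open>\<alpha> 2 < U < 1 - \<alpha> 1\<close> both exceed \<open>\<alpha> 2\<close>; and for
  \<open>1 - \<alpha> 1 \<le> U\<close> the second p-value is \<open>1 - U \<le> \<alpha> 1\<close>.
\<close>

lemma FDR_swap_law:
  fixes \<alpha> :: "nat \<Rightarrow> real"
  assumes \<alpha>: "0 < \<alpha> 1" "\<alpha> 1 < \<alpha> 2" "\<alpha> 1 + \<alpha> 2 < 1"
  shows "FDR (swap_law (\<alpha> 1)) 2 {1..2} (\<lambda>i x. x i) (step_up 2 \<alpha>) = \<alpha> 1 + \<alpha> 2"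
proof -
  let ?h = "\<lambda>u. \<lambda>i\<in>{1..2::nat}. if i = 1 then u else swap_ends (\<alpha> 1) u"
  have [measurable]: "(\<lambda>x. x 1) \<in> borel_measurable (unit_cube 2)" "(\<lambda>x. x 2) \<in> borel_measurable (unit_cube 2)"
    using unit_cube_coordinate_measurable[of _ 2] by simp_all
  have "FDR (swap_law (\<alpha> 1)) 2 {1..2} (\<lambda>i x. x i) (step_up 2 \<alpha>)
      = (\<integral>x. of_bool (rejects_some \<alpha> x) \<partial>swap_law (\<alpha> 1))"
    unfolding FDR_def using FDP_all_true_eq_indicator[of \<alpha>] \<alpha> by (simp del: One_nat_def)
  also have "\<dots> = (\<integral>u. of_bool (rejects_some \<alpha> (?h u)) \<partial>restrict_space lborel {0..1})"
    unfolding swap_law_def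
  proof (rule integral_distr[OF swap_law_map_measurable])
    show "(\<lambda>x. of_bool (rejects_some \<alpha> x)) \<in> borel_measurable (unit_cube 2)"
      unfolding rejects_some_def of_bool_def by measurable
  qed
  also have "\<dots> = (\<integral>u. indicator ({0..\<alpha> 2} \<union> {1 - \<alpha> 1..1}) u \<partial>restrict_space lborel {0..1})"
  proof (rule Bochner_Integration.integral_cong[OF refl])
    fix u :: real assume "u \<in> space (restrict_space lborel {0..1})"
    then show "of_bool (rejects_some \<alpha> (?h u)) = (indicator ({0..\<alpha> 2} \<union> {1 - \<alpha> 1..1}) u :: real)"
      using \<alpha> by (auto simp: rejects_some_def swap_ends_def indicator_def space_restrict_space simp del: One_nat_def)
  qed
  also have "\<dots> = measure (restrict_space lborel {0..1}) ({0..\<alpha> 2} \<union> {1 - \<alpha> 1..1})"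
  proof -
    have "({0..\<alpha> 2} \<union> {1 - \<alpha> 1..1}) \<inter> {0..1} = {0..\<alpha> 2} \<union> {1 - \<alpha> 1..1}"
      using \<alpha> by auto
    then show ?thesis by (simp add: space_restrict_space del: One_nat_def)
  qed
  also have "\<dots> = measure lborel ({0..\<alpha> 2} \<union> {1 - \<alpha> 1..1})"
    using \<alpha> by (intro measure_restrict_space) auto
  also have "\<dots> = measure lborel {0..\<alpha> 2} + measure lborel {1 - \<alpha> 1..1}"
    using \<alpha> by (intro measure_Un_AE) (auto simp: fmeasurable_def emeasure_lborel_Icc_eq)
  also have "\<dots> = \<alpha> 1 + \<alpha> 2" using \<alpha> by simp
  finally show ?thesis .
qed

theorem lemma5:
  fixes \<alpha> :: "nat \<Rightarrow> real"
  assumes "0 < \<alpha> 1" and "\<alpha> 1 < \<alpha> 2" and "\<alpha> 2 < 1"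
  shows "(\<forall>(M :: 'a measure) p I\<^sub>0. uniform_pvalues M 2 p \<longrightarrow> I\<^sub>0 \<subseteq> {1..2} \<longrightarrow>
            FDR M 2 I\<^sub>0 p (step_up 2 \<alpha>) \<le> min (\<alpha> 1 + \<alpha> 2) 1)
       \<and> (\<alpha> 1 + \<alpha> 2 < 1 \<longrightarrow>
            (\<exists>(P :: (nat \<Rightarrow> real) measure) I\<^sub>0. sets P = sets (unit_cube 2) \<and>
               uniform_pvalues P 2 (\<lambda>i x. x i) \<and> I\<^sub>0 \<subseteq> {1..2} \<and>
               FDR P 2 I\<^sub>0 (\<lambda>i x. x i) (step_up 2 \<alpha>) = \<alpha> 1 + \<alpha> 2))"
proof (intro conjI allI impI)
  fix M :: "'a measure" and p and I\<^sub>0 :: "nat set"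
  assume "uniform_pvalues M 2 p" "I\<^sub>0 \<subseteq> {1..2}"
  with assms show "FDR M 2 I\<^sub>0 p (step_up 2 \<alpha>) \<le> min (\<alpha> 1 + \<alpha> 2) 1"
    by (intro FDR_step_up_two_le)
next
  assume "\<alpha> 1 + \<alpha> 2 < 1"
  with assms have "FDR (swap_law (\<alpha> 1)) 2 {1..2} (\<lambda>i x. x i) (step_up 2 \<alpha>) = \<alpha> 1 + \<alpha> 2"
    by (intro FDR_swap_law)
  moreover have "sets (swap_law (\<alpha> 1)) = sets (unit_cube 2)"
    by (simp add: swap_law_def)
  ultimately show "\<exists>(P :: (nat \<Rightarrow> real) measure) I\<^sub>0. sets P = sets (unit_cube 2) \<and>
      uniform_pvalues P 2 (\<lambda>i x. x i) \<and> I\<^sub>0 \<subseteq> {1..2} \<and>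
      FDR P 2 I\<^sub>0 (\<lambda>i x. x i) (step_up 2 \<alpha>) = \<alpha> 1 + \<alpha> 2"
    using uniform_pvalues_swap_law by blast
qed

end
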